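(* Every finitely complete pointed majority category is centralic.
   Context: A category $\mathbb{C}$ is a majority category if every internal ternary relation $R$ between any objects $X,Y,Z$ of $\mathbb{C}$ (for $\mathbb{C}$ finitely complete: every subobject $R$ of $X\times Y\times Z$) satisfies, for all generalised elements $x,x'\colon S\to X$, $y,y'\colon S\to Y$, $z,z'\colon S\to Z$ with common domain $S$, $$(x,y,z')\in R\ \text{ and }\ (x,y',z)\in R\ \text{ and }\ (x',y,z)\in R\ \implies\ (x,y,z)\in R,$$ where $(a,b,c)\in R$ means that the morphism $(a,b,c)\colon S\to X\times Y\times Z$ factors through $R$. A pointed category is a category with a zero object $0$; zero morphisms are also denoted $0$. For morphisms $x\colon S\to X$, $y\colon S\to Y$, $f\colon X\times Y\to Z$, write $f(x,y)$ for the composite $f\circ(x,y)\colon S\to Z$. A pointed category with finite products is called centralic if for every morphism $f\colon X\times Y\to Z$, every object $S$ and all morphisms $x,x'\colon S\to X$, $y\colon S\to Y$: $f(x,0)=f(x',0)$ implies $f(x,y)=f(x',y)$. *)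

theory Defs
  imports Main
begin

record ('o, 'm) cat =
  Obj :: "'o set"
  Arr :: "'m set"
  Dom :: "'m \<Rightarrow> 'o"
  Cod :: "'m \<Rightarrow> 'o"
  Ident :: "'o \<Rightarrow> 'm"
  Comp :: "'m \<Rightarrow> 'm \<Rightarrow> 'm"  (infixr "\<cdot>\<index>" 70)

definition hom :: "('o, 'm) cat \<Rightarrow> 'o \<Rightarrow> 'o \<Rightarrow> 'm set" where
  "hom C A B = {f \<in> Arr C. Dom C f = A \<and> Cod C f = B}"

locale category =
  fixes C :: "('o, 'm) cat" (structure)
  assumes Dom_Obj: "f \<in> Arr C \<Longrightarrow> Dom C f \<in> Obj C"
    and Cod_Obj: "f \<in> Arr C \<Longrightarrow> Cod C f \<in> Obj C"
    and Ident_hom: "A \<in> Obj C \<Longrightarrow> Ident C A \<in> hom C A A"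
    and Comp_hom: "\<lbrakk>f \<in> hom C A B; g \<in> hom C B D\<rbrakk> \<Longrightarrow> g \<cdot> f \<in> hom C A D"
    and Ident_left: "f \<in> hom C A B \<Longrightarrow> Ident C B \<cdot> f = f"
    and Ident_right: "f \<in> hom C A B \<Longrightarrow> f \<cdot> Ident C A = f"
    and Comp_assoc:
      "\<lbrakk>f \<in> hom C A B; g \<in> hom C B D; h \<in> hom C D E\<rbrakk> \<Longrightarrow> (h \<cdot> g) \<cdot> f = h \<cdot> (g \<cdot> f)"

definition diagram ::
  "('i, 'u) cat \<Rightarrow> ('o, 'm) cat \<Rightarrow> ('i \<Rightarrow> 'o) \<Rightarrow> ('u \<Rightarrow> 'm) \<Rightarrow> bool" where
  "diagram J C Fo Fm \<longleftrightarrow> category J \<and> category C \<and>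
     (\<forall>j\<in>Obj J. Fo j \<in> Obj C) \<and>
     (\<forall>u\<in>Arr J. Fm u \<in> hom C (Fo (Dom J u)) (Fo (Cod J u))) \<and>
     (\<forall>j\<in>Obj J. Fm (Ident J j) = Ident C (Fo j)) \<and>
     (\<forall>u\<in>Arr J. \<forall>v\<in>Arr J. Cod J u = Dom J v \<longrightarrow> Fm (v \<cdot>\<^bsub>J\<^esub> u) = Fm v \<cdot>\<^bsub>C\<^esub> Fm u)"

definition cone ::
  "('i, 'u) cat \<Rightarrow> ('o, 'm) cat \<Rightarrow> ('i \<Rightarrow> 'o) \<Rightarrow> ('u \<Rightarrow> 'm) \<Rightarrow> 'o \<Rightarrow> ('i \<Rightarrow> 'm) \<Rightarrow> bool" where
  "cone J C Fo Fm L p \<longleftrightarrow> L \<in> Obj C \<and>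
     (\<forall>j\<in>Obj J. p j \<in> hom C L (Fo j)) \<and>
     (\<forall>u\<in>Arr J. Fm u \<cdot>\<^bsub>C\<^esub> p (Dom J u) = p (Cod J u))"

definition limit_cone ::
  "('i, 'u) cat \<Rightarrow> ('o, 'm) cat \<Rightarrow> ('i \<Rightarrow> 'o) \<Rightarrow> ('u \<Rightarrow> 'm) \<Rightarrow> 'o \<Rightarrow> ('i \<Rightarrow> 'm) \<Rightarrow> bool" where
  "limit_cone J C Fo Fm L p \<longleftrightarrow> cone J C Fo Fm L p \<and>
     (\<forall>S s. cone J C Fo Fm S s \<longrightarrow>
        (\<exists>!h. h \<in> hom C S L \<and> (\<forall>j\<in>Obj J. p j \<cdot>\<^bsub>C\<^esub> h = s j)))"

text \<open>Every finite category is isomorphic to one whose objects and arrows are natural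
  numbers, so indexing by \<^typ>\<open>(nat, nat) cat\<close> covers all finite diagrams.\<close>

definition finitely_complete :: "('o, 'm) cat \<Rightarrow> bool" where
  "finitely_complete C \<longleftrightarrow> category C \<and>
     (\<forall>(J :: (nat, nat) cat) Fo Fm.
        finite (Obj J) \<and> finite (Arr J) \<and> diagram J C Fo Fm \<longrightarrow>
        (\<exists>L p. limit_cone J C Fo Fm L p))"

text \<open>A product of a list of objects is an object with a list of projections of the same
  length; the product of the empty list is a terminal object.\<close>

definition is_product :: "('o, 'm) cat \<Rightarrow> 'o list \<Rightarrow> 'o \<Rightarrow> 'm list \<Rightarrow> bool" where
  "is_product C Xs P ps \<longleftrightarrow> set Xs \<subseteq> Obj C \<and> P \<in> Obj C \<and>
     list_all2 (\<lambda>p X. p \<in> hom C P X) ps Xs \<and>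
     (\<forall>S\<in>Obj C. \<forall>fs. list_all2 (\<lambda>f X. f \<in> hom C S X) fs Xs \<longrightarrow>
        (\<exists>!h. h \<in> hom C S P \<and> map (\<lambda>p. p \<cdot>\<^bsub>C\<^esub> h) ps = fs))"

definition has_finite_products :: "('o, 'm) cat \<Rightarrow> bool" where
  "has_finite_products C \<longleftrightarrow> category C \<and>
     (\<forall>Xs. set Xs \<subseteq> Obj C \<longrightarrow> (\<exists>P ps. is_product C Xs P ps))"

text \<open>The morphism \<open>(f\<^sub>1, \<dots>, f\<^sub>n) : S \<rightarrow> P\<close> induced by the product
  \<open>P\<close> with projections \<open>ps\<close>.\<close>

definition tuple :: "('o, 'm) cat \<Rightarrow> 'o \<Rightarrow> 'm list \<Rightarrow> 'o \<Rightarrow> 'm list \<Rightarrow> 'm" where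
  "tuple C P ps S fs = (THE h. h \<in> hom C S P \<and> map (\<lambda>p. p \<cdot>\<^bsub>C\<^esub> h) ps = fs)"

definition zero_object :: "('o, 'm) cat \<Rightarrow> 'o \<Rightarrow> bool" where
  "zero_object C Z \<longleftrightarrow> Z \<in> Obj C \<and>
     (\<forall>X\<in>Obj C. (\<exists>!f. f \<in> hom C X Z) \<and> (\<exists>!f. f \<in> hom C Z X))"

definition pointed :: "('o, 'm) cat \<Rightarrow> bool" where
  "pointed C \<longleftrightarrow> category C \<and> (\<exists>Z. zero_object C Z)"

definition zero_morphism :: "('o, 'm) cat \<Rightarrow> 'o \<Rightarrow> 'o \<Rightarrow> 'm" where
  "zero_morphism C X Y =
     (THE f. \<exists>Z g h. zero_object C Z \<and> g \<in> hom C X Z \<and> h \<in> hom C Z Y \<and> f = h \<cdot>\<^bsub>C\<^esub> g)"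

definition monic :: "('o, 'm) cat \<Rightarrow> 'm \<Rightarrow> bool" where
  "monic C r \<longleftrightarrow> r \<in> Arr C \<and>
     (\<forall>S. \<forall>f\<in>hom C S (Dom C r). \<forall>g\<in>hom C S (Dom C r).
        r \<cdot>\<^bsub>C\<^esub> f = r \<cdot>\<^bsub>C\<^esub> g \<longrightarrow> f = g)"

definition factors_through :: "('o, 'm) cat \<Rightarrow> 'm \<Rightarrow> 'm \<Rightarrow> bool" where
  "factors_through C f r \<longleftrightarrow> (\<exists>g\<in>hom C (Dom C f) (Dom C r). f = r \<cdot>\<^bsub>C\<^esub> g)"

text \<open>A relation between \<open>X\<close>, \<open>Y\<close>, \<open>Z\<close> is given by a monomorphism \<open>r\<close> into
  a product \<open>P\<close> of \<open>X\<close>, \<open>Y\<close>, \<open>Z\<close>. Representing relations by subobjects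
  of products is adequate only when these products exist, so this definition is meant for
  finitely complete categories.\<close>

definition majority_category :: "('o, 'm) cat \<Rightarrow> bool" where
  "majority_category C \<longleftrightarrow> category C \<and>
     (\<forall>X Y Z P ps R r. is_product C [X, Y, Z] P ps \<and> r \<in> hom C R P \<and> monic C r \<longrightarrow>
        (\<forall>S. \<forall>x\<in>hom C S X. \<forall>x'\<in>hom C S X. \<forall>y\<in>hom C S Y. \<forall>y'\<in>hom C S Y.
             \<forall>z\<in>hom C S Z. \<forall>z'\<in>hom C S Z.
           factors_through C (tuple C P ps S [x, y, z']) r \<and>
           factors_through C (tuple C P ps S [x, y', z]) r \<and>
           factors_through C (tuple C P ps S [x', y, z]) r \<longrightarrow>
           factors_through C (tuple C P ps S [x, y, z]) r))"

definition centralic :: "('o, 'm) cat \<Rightarrow> bool" where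
  "centralic C \<longleftrightarrow> pointed C \<and> has_finite_products C \<and>
     (\<forall>X Y Z P ps f. is_product C [X, Y] P ps \<and> f \<in> hom C P Z \<longrightarrow>
        (\<forall>S. \<forall>x\<in>hom C S X. \<forall>x'\<in>hom C S X. \<forall>y\<in>hom C S Y.
           f \<cdot>\<^bsub>C\<^esub> tuple C P ps S [x, zero_morphism C S Y] =
           f \<cdot>\<^bsub>C\<^esub> tuple C P ps S [x', zero_morphism C S Y] \<longrightarrow>
           f \<cdot>\<^bsub>C\<^esub> tuple C P ps S [x, y] = f \<cdot>\<^bsub>C\<^esub> tuple C P ps S [x', y]))"

end

theory Submission
  imports Defs
begin

text \<open>
  In a variety with a majority term \<open>m\<close>, a homomorphism \<open>f\<close> with
  \<open>f(x, 0) = f(x', 0)\<close> satisfies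
  \<open>f(x, y) = m(f(x, 0), f(x', y), f(x, y)) = m(f(x', 0), f(x', y), f(x, y)) = f(x', y)\<close>,
  because \<open>f\<close> commutes with \<open>m\<close> and two of the three entries agree in every
  coordinate. The relation behind this computation is
  \<open>R = {(a, b, c). f(a, c) = f(b, c)}\<close> on \<open>X\<close>, \<open>X\<close>, \<open>Y\<close>, the equalizer
  of two morphisms out of \<open>X \<times> X \<times> Y\<close>. It contains \<open>(x, x', 0)\<close> by hypothesis,
  and \<open>(x, x, y)\<close> and \<open>(x', x', y)\<close> by reflexivity of equality. Each of these three triples
  differs from \<open>(x, x', y)\<close> in one coordinate, a different one each time, so the majority
  condition puts \<open>(x, x', y)\<close> into \<open>R\<close>, which is the claim.

  All four triples have the same domain \<open>S\<close>, so the zero morphism \<open>S \<rightarrow> Y\<close> enters as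
  one more generalised element of \<open>Y\<close> (\<open>zero_morphism_in_hom\<close>). The products and the
  equalizer are limits of explicit finite diagrams (\<open>finite_product_exists\<close>,
  \<open>equalizer_exists\<close>).
\<close>

section \<open>Finite products and equalizers as finite limits\<close>

lemma finite_limit_exists:
  fixes J :: "(nat, nat) cat"
  assumes "finitely_complete C" "finite (Obj J)" "finite (Arr J)" "diagram J C Fo Fm"
  obtains L p where "limit_cone J C Fo Fm L p"
proof -
  have "\<exists>L p. limit_cone J C Fo Fm L p"
    using assms by (simp add: finitely_complete_def)
  then show thesis using that by auto
qed

lemma limit_coneD:
  assumes "limit_cone J C Fo Fm L p"
  shows "cone J C Fo Fm L p"
    and "cone J C Fo Fm S s \<Longrightarrow> \<exists>!h. h \<in> hom C S L \<and> (\<forall>j\<in>Obj J. p j \<cdot>\<^bsub>C\<^esub> h = s j)"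
  using assms unfolding limit_cone_def by iprover+

definition discrete_cat :: "nat \<Rightarrow> (nat, nat) cat" where
  "discrete_cat n = \<lparr>Obj = {..<n}, Arr = {..<n}, Dom = id, Cod = id, Ident = id,
     Comp = (\<lambda>v u. u)\<rparr>"

lemma category_discrete_cat: "category (discrete_cat n)"
  by unfold_locales (auto simp: discrete_cat_def hom_def)

lemma finite_product_exists:
  assumes fc: "finitely_complete C" and Xs: "set Xs \<subseteq> Obj C"
  shows "\<exists>P ps. is_product C Xs P ps"
proof -
  interpret category C using fc by (simp add: finitely_complete_def)
  define J where "J = discrete_cat (length Xs)"
  define Fo where "Fo j = Xs ! j" for j
  define Fm where "Fm j = Ident C (Xs ! j)" for j
  have J: "category J" "Obj J = {..<length Xs}" "Arr J = {..<length Xs}"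
    "Dom J u = u" "Cod J u = u" "Ident J u = u" "v \<cdot>\<^bsub>J\<^esub> u = u" for u v
    using category_discrete_cat by (auto simp: J_def discrete_cat_def)
  have Xs_Obj: "j < length Xs \<Longrightarrow> Xs ! j \<in> Obj C" for j using Xs by auto
  have "diagram J C Fo Fm"
    using Xs_Obj Ident_hom Ident_left[OF Ident_hom] J category_axioms
    by (auto simp: diagram_def Fo_def Fm_def)
  then obtain L p where lim: "limit_cone J C Fo Fm L p"
    by (rule finite_limit_exists[OF fc, rotated 2]) (simp_all add: J)
  have cone_iff: "cone J C Fo Fm S s \<longleftrightarrow> S \<in> Obj C \<and> (\<forall>j<length Xs. s j \<in> hom C S (Xs ! j))"
    for S s
    using Ident_left by (auto simp: cone_def J Fo_def Fm_def)
  have "is_product C Xs L (map p [0..<length Xs])"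
    unfolding is_product_def
  proof (intro conjI ballI allI impI)
    show "set Xs \<subseteq> Obj C" by (fact Xs)
    show "L \<in> Obj C" using limit_coneD(1)[OF lim] by (simp add: cone_iff)
    show "list_all2 (\<lambda>p X. p \<in> hom C L X) (map p [0..<length Xs]) Xs"
      using limit_coneD(1)[OF lim] by (auto simp: cone_iff list_all2_conv_all_nth)
    fix S fs assume "S \<in> Obj C" and fs: "list_all2 (\<lambda>f X. f \<in> hom C S X) fs Xs"
    then have "cone J C Fo Fm S ((!) fs)"
      by (auto simp: cone_iff list_all2_conv_all_nth)
    then have ex1: "\<exists>!h. h \<in> hom C S L \<and> (\<forall>j\<in>Obj J. p j \<cdot>\<^bsub>C\<^esub> h = fs ! j)"
      by (rule limit_coneD(2)[OF lim])
    have fs_nth: "map ((!) fs) [0..<length Xs] = fs"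
      using list_all2_lengthD[OF fs] map_nth[of fs] by simp
    have "map (\<lambda>p. p \<cdot>\<^bsub>C\<^esub> h) (map p [0..<length Xs]) = map ((!) fs) [0..<length Xs]
      \<longleftrightarrow> (\<forall>j\<in>Obj J. p j \<cdot>\<^bsub>C\<^esub> h = fs ! j)" for h
      unfolding map_map map_eq_conv by (auto simp: J(2))
    then have tuple_iff: "map (\<lambda>p. p \<cdot>\<^bsub>C\<^esub> h) (map p [0..<length Xs]) = fs
      \<longleftrightarrow> (\<forall>j\<in>Obj J. p j \<cdot>\<^bsub>C\<^esub> h = fs ! j)" for h
      by (simp only: fs_nth)
    then show "\<exists>!h. h \<in> hom C S L \<and> map (\<lambda>p. p \<cdot>\<^bsub>C\<^esub> h) (map p [0..<length Xs]) = fs"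
      using ex1 by (simp only: tuple_iff)
  qed
  then show ?thesis by blast
qed

text \<open>The arrows \<open>0\<close> and \<open>1\<close> are the identities of the two objects \<open>0\<close> and \<open>1\<close>;
  \<open>2\<close> and \<open>3\<close> are the parallel arrows from \<open>0\<close> to \<open>1\<close>. In a composable pair
  at least one arrow is an identity, which gives the formula for composition.\<close>

definition parallel_pair_cat :: "(nat, nat) cat" where
  "parallel_pair_cat = \<lparr>Obj = {0, 1}, Arr = {0, 1, 2, 3},
     Dom = (\<lambda>u. if u = 1 then 1 else 0), Cod = (\<lambda>u. if u = 0 then 0 else 1), Ident = id,
     Comp = (\<lambda>v u. if u < 2 then v else u)\<rparr>"

lemma category_parallel_pair_cat: "category parallel_pair_cat"
proof -
  have hom_iff: "u \<in> hom parallel_pair_cat A B \<longleftrightarrow>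
      u = 0 \<and> A = 0 \<and> B = 0 \<or> u = 1 \<and> A = 1 \<and> B = 1 \<or> (u = 2 \<or> u = 3) \<and> A = 0 \<and> B = 1"
    for u A B
    by (auto simp: hom_def parallel_pair_cat_def)
  show ?thesis
    unfolding category_def hom_iff by (auto simp: parallel_pair_cat_def)
qed

lemma equalizer_exists:
  assumes fc: "finitely_complete C" and u: "u \<in> hom C A B" and v: "v \<in> hom C A B"
  shows "\<exists>E e. e \<in> hom C E A \<and> u \<cdot>\<^bsub>C\<^esub> e = v \<cdot>\<^bsub>C\<^esub> e \<and>
    (\<forall>S. \<forall>s\<in>hom C S A. u \<cdot>\<^bsub>C\<^esub> s = v \<cdot>\<^bsub>C\<^esub> s \<longrightarrow> (\<exists>!h. h \<in> hom C S E \<and> e \<cdot>\<^bsub>C\<^esub> h = s))"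
proof -
  interpret category C using fc by (simp add: finitely_complete_def)
  let ?J = parallel_pair_cat
  define Fo where "Fo j = (if j = 0 then A else B)" for j :: nat
  define Fm where "Fm j = (if j = 0 then Ident C A else if j = 1 then Ident C B
    else if j = 2 then u else v)" for j :: nat
  have AB: "A \<in> Obj C" "B \<in> Obj C"
    using u Dom_Obj Cod_Obj by (auto simp: hom_def)
  note ids = Ident_hom[OF AB(1)] Ident_hom[OF AB(2)]
  have "diagram ?J C Fo Fm"
    unfolding diagram_def
    using category_parallel_pair_cat category_axioms AB u v ids
      Ident_left[OF u] Ident_left[OF v] Ident_right[OF u] Ident_right[OF v]
      Ident_left[OF ids(1)] Ident_left[OF ids(2)]
    by (simp add: parallel_pair_cat_def Fo_def Fm_def)
  then obtain L p where lim: "limit_cone ?J C Fo Fm L p"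
    by (rule finite_limit_exists[OF fc, rotated 2]) (simp_all add: parallel_pair_cat_def)
  have cone_iff: "cone ?J C Fo Fm S s \<longleftrightarrow>
      s 0 \<in> hom C S A \<and> s 1 = u \<cdot>\<^bsub>C\<^esub> s 0 \<and> s 1 = v \<cdot>\<^bsub>C\<^esub> s 0" for S s
    using Comp_hom[OF _ u, of "s 0" S] Ident_left Dom_Obj
    by (auto simp: cone_def parallel_pair_cat_def Fo_def Fm_def hom_def)
  have pL: "p 0 \<in> hom C L A" "p 1 = u \<cdot>\<^bsub>C\<^esub> p 0" "u \<cdot>\<^bsub>C\<^esub> p 0 = v \<cdot>\<^bsub>C\<^esub> p 0"
    using limit_coneD(1)[OF lim] by (auto simp: cone_iff)
  have "\<exists>!h. h \<in> hom C S L \<and> p 0 \<cdot>\<^bsub>C\<^esub> h = s"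
    if s: "s \<in> hom C S A" "u \<cdot>\<^bsub>C\<^esub> s = v \<cdot>\<^bsub>C\<^esub> s" for S s
  proof -
    define t where "t j = (if j = 0 then s else u \<cdot>\<^bsub>C\<^esub> s)" for j :: nat
    have "cone ?J C Fo Fm S t" using s by (simp add: cone_iff t_def)
    then have ex1: "\<exists>!h. h \<in> hom C S L \<and> (\<forall>j\<in>Obj ?J. p j \<cdot>\<^bsub>C\<^esub> h = t j)"
      by (rule limit_coneD(2)[OF lim])
    have equalizes_iff: "h \<in> hom C S L \<and> (\<forall>j\<in>Obj ?J. p j \<cdot>\<^bsub>C\<^esub> h = t j)
      \<longleftrightarrow> h \<in> hom C S L \<and> p 0 \<cdot>\<^bsub>C\<^esub> h = s" for h
      using Comp_assoc[OF _ pL(1) u, of h S] pL(2) by (auto simp: parallel_pair_cat_def t_def)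
    then show ?thesis using ex1 by (simp only: equalizes_iff)
  qed
  then show ?thesis using pL(1,3) by (intro exI[of _ L] exI[of _ "p 0"] conjI allI ballI impI)
qed

section \<open>Tuples, equalizers and zero morphisms\<close>

context category
begin

lemma tuple_in_hom:
  assumes "is_product C Xs P ps" "S \<in> Obj C" "list_all2 (\<lambda>f X. f \<in> hom C S X) fs Xs"
  shows "tuple C P ps S fs \<in> hom C S P" "map (\<lambda>p. p \<cdot> tuple C P ps S fs) ps = fs"
proof -
  have "\<exists>!h. h \<in> hom C S P \<and> map (\<lambda>p. p \<cdot> h) ps = fs"
    using assms by (simp add: is_product_def)
  from theI'[OF this]
  show "tuple C P ps S fs \<in> hom C S P" "map (\<lambda>p. p \<cdot> tuple C P ps S fs) ps = fs"
    by (simp_all add: tuple_def)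
qed

lemma tuple_eqI:
  assumes "is_product C Xs P ps" "S \<in> Obj C" "list_all2 (\<lambda>f X. f \<in> hom C S X) fs Xs"
    and "h \<in> hom C S P" "map (\<lambda>p. p \<cdot> h) ps = fs"
  shows "h = tuple C P ps S fs"
proof -
  have "\<exists>!h. h \<in> hom C S P \<and> map (\<lambda>p. p \<cdot> h) ps = fs"
    using assms by (simp add: is_product_def)
  then show ?thesis
    using assms(4,5) tuple_in_hom[OF assms(1-3)] by blast
qed

lemma tuple_comp:
  assumes prod: "is_product C Xs P ps" and fs: "list_all2 (\<lambda>f X. f \<in> hom C T X) fs Xs"
    and h: "h \<in> hom C S T"
  shows "tuple C P ps T fs \<cdot> h = tuple C P ps S (map (\<lambda>f. f \<cdot> h) fs)"
proof (rule tuple_eqI[OF prod])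
  have T: "T \<in> Obj C" and S: "S \<in> Obj C"
    using h Dom_Obj Cod_Obj by (auto simp: hom_def)
  note t = tuple_in_hom[OF prod T fs]
  show "S \<in> Obj C" by (fact S)
  show "list_all2 (\<lambda>f X. f \<in> hom C S X) (map (\<lambda>f. f \<cdot> h) fs) Xs"
    using fs Comp_hom[OF h] by (auto simp: list_all2_conv_all_nth)
  show "tuple C P ps T fs \<cdot> h \<in> hom C S P" by (rule Comp_hom[OF h t(1)])
  have "p \<cdot> (tuple C P ps T fs \<cdot> h) = (p \<cdot> tuple C P ps T fs) \<cdot> h" if p: "p \<in> set ps" for p
  proof -
    obtain X where "p \<in> hom C P X"
      using prod p by (auto simp: is_product_def list_all2_conv_all_nth in_set_conv_nth)
    then show ?thesis using Comp_assoc[OF h t(1)] by simp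
  qed
  then have "map (\<lambda>p. p \<cdot> (tuple C P ps T fs \<cdot> h)) ps
      = map (\<lambda>f. f \<cdot> h) (map (\<lambda>p. p \<cdot> tuple C P ps T fs) ps)"
    by simp
  then show "map (\<lambda>p. p \<cdot> (tuple C P ps T fs \<cdot> h)) ps = map (\<lambda>f. f \<cdot> h) fs"
    by (simp only: t(2))
qed

text \<open>This is how the equation \<open>u(a) = v(a)\<close> becomes a relation to which the majority
  condition applies: the uniqueness half of the universal property of the equalizer makes
  it monic, the existence half turns the equation into membership.\<close>

lemma equalizer_relation:
  assumes "finitely_complete C" and u: "u \<in> hom C A B" and v: "v \<in> hom C A B"
  obtains E e where "e \<in> hom C E A" "monic C e"
    "\<forall>S. \<forall>s\<in>hom C S A. factors_through C s e \<longleftrightarrow> u \<cdot> s = v \<cdot> s"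
proof -
  obtain E e where e: "e \<in> hom C E A" and eq: "u \<cdot> e = v \<cdot> e"
    and univ: "\<And>S s. s \<in> hom C S A \<Longrightarrow> u \<cdot> s = v \<cdot> s \<Longrightarrow> \<exists>!h. h \<in> hom C S E \<and> e \<cdot> h = s"
    using equalizer_exists[OF assms] by blast
  have equalizes: "u \<cdot> (e \<cdot> g) = v \<cdot> (e \<cdot> g)" if "g \<in> hom C S E" for S g
    using Comp_assoc[OF that e u] Comp_assoc[OF that e v] eq by simp
  have Dom_e: "Dom C e = E" "e \<in> Arr C" using e by (auto simp: hom_def)
  have "monic C e"
    unfolding monic_def Dom_e using Dom_e(2) univ[OF Comp_hom[OF _ e] equalizes] by blast
  moreover have "factors_through C s e \<longleftrightarrow> u \<cdot> s = v \<cdot> s" if s: "s \<in> hom C S A" for S s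
  proof -
    have "Dom C s = S" using s by (simp add: hom_def)
    then show ?thesis
      unfolding factors_through_def Dom_e using equalizes univ[OF s] by blast
  qed
  ultimately show thesis using that e by blast
qed

text \<open>The composite through a zero object does not depend on the zero object, since any
  two zero objects are connected by a morphism compatible with all morphisms into and out of
  them. Hence the description defining \<^const>\<open>zero_morphism\<close> denotes.\<close>

lemma zero_morphism_in_hom:
  assumes "pointed C" and X: "X \<in> Obj C" and Y: "Y \<in> Obj C"
  shows "zero_morphism C X Y \<in> hom C X Y"
proof -
  let ?Q = "\<lambda>f. \<exists>Z g h. zero_object C Z \<and> g \<in> hom C X Z \<and> h \<in> hom C Z Y \<and> f = h \<cdot> g"
  have uniq: "h \<cdot> g = h' \<cdot> g'"
    if zeros: "zero_object C Z" "g \<in> hom C X Z" "h \<in> hom C Z Y"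
      "zero_object C Z'" "g' \<in> hom C X Z'" "h' \<in> hom C Z' Y" for Z g h Z' g' h'
  proof -
    have ex1: "\<exists>!f. f \<in> hom C X Z'" "\<exists>!f. f \<in> hom C Z Y" "\<exists>!f. f \<in> hom C Z Z'"
      using zeros(1,4) X Y by (simp_all add: zero_object_def)
    then obtain k where k: "k \<in> hom C Z Z'" by blast
    have "k \<cdot> g = g'"
      using ex1(1) Comp_hom[OF zeros(2) k] zeros(5) by blast
    moreover have "h' \<cdot> k = h"
      using ex1(2) Comp_hom[OF k zeros(6)] zeros(3) by blast
    ultimately show ?thesis using Comp_assoc[OF zeros(2) k zeros(6)] by simp
  qed
  obtain Z where Z: "zero_object C Z" using assms by (auto simp: pointed_def)
  then have "\<exists>g. g \<in> hom C X Z" "\<exists>h. h \<in> hom C Z Y"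
    using X Y by (auto simp: zero_object_def)
  then obtain g h where "g \<in> hom C X Z" "h \<in> hom C Z Y" by blast
  then have "?Q (h \<cdot> g)" using Z by blast
  then have "\<exists>!f. ?Q f"
  proof (rule ex1I)
    fix f assume "?Q f"
    then show "f = h \<cdot> g" using uniq Z \<open>g \<in> hom C X Z\<close> \<open>h \<in> hom C Z Y\<close> by blast
  qed
  then have "?Q (zero_morphism C X Y)" unfolding zero_morphism_def by (rule theI')
  then obtain Z g h where "g \<in> hom C X Z" "h \<in> hom C Z Y" "zero_morphism C X Y = h \<cdot> g"
    by blast
  then show ?thesis using Comp_hom[of g X Z h Y] by simp
qed

end

section \<open>Majority categories are centralic\<close>

text \<open>The computation with \<open>R = {(a, b, c). f(a, c) = f(b, c)}\<close>, for an arbitrary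
  \<open>w\<close> in place of the zero morphism.\<close>

lemma majority_transfer:
  assumes fc: "finitely_complete C" and maj: "majority_category C"
    and prod: "is_product C [X, Y] P ps" and f: "f \<in> hom C P Z"
    and x: "x \<in> hom C S X" and x': "x' \<in> hom C S X"
    and y: "y \<in> hom C S Y" and w: "w \<in> hom C S Y"
    and eq: "f \<cdot>\<^bsub>C\<^esub> tuple C P ps S [x, w] = f \<cdot>\<^bsub>C\<^esub> tuple C P ps S [x', w]"
  shows "f \<cdot>\<^bsub>C\<^esub> tuple C P ps S [x, y] = f \<cdot>\<^bsub>C\<^esub> tuple C P ps S [x', y]"
proof -
  interpret category C using fc by (simp add: finitely_complete_def)
  have S: "S \<in> Obj C" using x Dom_Obj by (auto simp: hom_def)
  have "set [X, X, Y] \<subseteq> Obj C" using prod by (auto simp: is_product_def)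
  then obtain T ts where T: "is_product C [X, X, Y] T ts"
    using finite_product_exists[OF fc] by blast
  then obtain q1 q2 q3 where ts: "ts = [q1, q2, q3]"
    and q: "q1 \<in> hom C T X" "q2 \<in> hom C T X" "q3 \<in> hom C T Y"
    by (auto simp: is_product_def list_all2_Cons2)
  have T_Obj: "T \<in> Obj C" using T by (simp add: is_product_def)
  define pair where "pair a c = tuple C P ps T [a, c]" for a c
  have pair: "pair a c \<in> hom C T P" if "a \<in> hom C T X" "c \<in> hom C T Y" for a c
    unfolding pair_def using that by (intro tuple_in_hom(1)[OF prod T_Obj]) simp
  let ?u = "f \<cdot>\<^bsub>C\<^esub> pair q1 q3" and ?v = "f \<cdot>\<^bsub>C\<^esub> pair q2 q3"
  have uv: "?u \<in> hom C T Z" "?v \<in> hom C T Z"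
    using Comp_hom[OF pair f] q by auto
  obtain R r where r: "r \<in> hom C R T" "monic C r"
    and R: "\<forall>S. \<forall>s\<in>hom C S T. factors_through C s r \<longleftrightarrow> ?u \<cdot>\<^bsub>C\<^esub> s = ?v \<cdot>\<^bsub>C\<^esub> s"
    by (rule equalizer_relation[OF fc uv]) (rule that)
  have mem: "factors_through C (tuple C T ts S [a, b, c]) r \<longleftrightarrow>
      f \<cdot>\<^bsub>C\<^esub> tuple C P ps S [a, c] = f \<cdot>\<^bsub>C\<^esub> tuple C P ps S [b, c]"
    if "a \<in> hom C S X" "b \<in> hom C S X" "c \<in> hom C S Y" for a b c
  proof -
    let ?t = "tuple C T ts S [a, b, c]"
    have "list_all2 (\<lambda>f X. f \<in> hom C S X) [a, b, c] [X, X, Y]" using that by simp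
    note t = tuple_in_hom[OF T S this]
    then have proj: "q1 \<cdot>\<^bsub>C\<^esub> ?t = a" "q2 \<cdot>\<^bsub>C\<^esub> ?t = b" "q3 \<cdot>\<^bsub>C\<^esub> ?t = c"
      by (simp_all add: ts)
    have "(f \<cdot>\<^bsub>C\<^esub> pair d q3) \<cdot>\<^bsub>C\<^esub> ?t = f \<cdot>\<^bsub>C\<^esub> tuple C P ps S [d \<cdot>\<^bsub>C\<^esub> ?t, c]"
      if d: "d \<in> hom C T X" for d
      using Comp_assoc[OF t(1) pair[OF d q(3)] f] tuple_comp[OF prod _ t(1), of "[d, q3]"]
        d q(3) proj(3)
      by (simp add: pair_def)
    then show ?thesis using R[rule_format, OF t(1)] q(1,2) proj by simp
  qed
  have "factors_through C (tuple C T ts S [x, x', w]) r" using mem x x' w eq by blast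
  moreover have "factors_through C (tuple C T ts S [x, x, y]) r" using mem x y by blast
  moreover have "factors_through C (tuple C T ts S [x', x', y]) r" using mem x' y by blast
  ultimately have "factors_through C (tuple C T ts S [x, x', y]) r"
    using maj T r x x' y w unfolding majority_category_def by blast
  then show ?thesis using mem x x' y by blast
qed

theorem proposition2p12:
  fixes C :: "('o, 'm) cat"
  assumes "finitely_complete C" and "pointed C" and "majority_category C"
  shows "centralic C"
proof -
  interpret category C using assms(1) by (simp add: finitely_complete_def)
  have "has_finite_products C"
    using finite_product_exists[OF assms(1)] category_axioms by (simp add: has_finite_products_def)
  moreover have "zero_morphism C S Y \<in> hom C S Y" if "y \<in> hom C S Y" for S Y y
    using zero_morphism_in_hom[OF assms(2)] that Dom_Obj Cod_Obj by (auto simp: hom_def)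
  ultimately show ?thesis
    using majority_transfer[OF assms(1,3)] assms(2) unfolding centralic_def by blast
qed

end
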